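(* Let $\mathcal M=\langle W,R,\{\mathcal M_w\}_{w\in W}\rangle$ be a concrete mixed model with $\mathcal M_w=\langle W_w,\leq_w,V_w\rangle$. Define $\mathcal M'=\langle W',\leq',R',V'\rangle$ by: $W':=\bigcup_{w\in W}W_w$; $xR'y$ iff there are $w,v\in W$ with $wRv$, $\overline w\leq_w x$ and $y=\overline v$; $x\leq'y$ iff $x\leq_w y$ for some $w\in W$; $V'(x):=V_w(x)$ for the unique $w$ with $x\in W_w$. Then $\mathcal M'$ is a birelational model satisfying $\mathsf{BEM}$, and for every $x\in W'$ and every $\varphi\in\mathsf{Form}_\Box$, $\mathcal M,x\Vdash\varphi$ if and only if $\mathcal M',x\Vdash\varphi$.
   Context: The modal language $\mathsf{Form}_\Box$ is generated by $\top$, $\bot$, propositional variables $p\in\mathsf{Prop}$, $\wedge,\vee,\to$ and $\Box$. A concrete mixed model is $\langle W,R,\{\mathcal M_w\}_{w\in W}\rangle$ with $W\ne\emptyset$, $R\subseteq W\times W$, each $\mathcal M_w=\langle W_w,\leq_w,V_w\rangle$ a rooted intuitionistic Kripke model (partial order $\leq_w$ with least element $\overline w$, valuation $V_w:W_w\to\mathcal P(\mathsf{Prop})$ monotone in $\leq_w$), the $W_w$ pairwise disjoint; $\leq,V$ denote the unions. Forcing at a point $x\in\bigcup_wW_w$: $x\Vdash p$ iff $p\in V(x)$; $x\nVdash\bot$; $\wedge,\vee$ pointwise; $x\Vdash\varphi\to\psi$ iff every $y\geq x$ forcing $\varphi$ forces $\psi$; $x\Vdash\Box\varphi$ iff $\overline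 v\Vdash\varphi$ for all $v\in W$ with $wRv$, where $w$ is the unique element with $\overline w\leq x$. A birelational model is $\langle U,\leq,R,V\rangle$ with $U\ne\emptyset$, $\leq$ a partial order, $R\subseteq U\times U$ such that $x\leq y$ and $yRz$ imply $xRz$, and $V:U\to\mathcal P(\mathsf{Prop})$ monotone in $\leq$. Forcing is as in intuitionistic Kripke models for propositional clauses, and $x\Vdash\Box\varphi$ iff $y\Vdash\varphi$ for all $y$ with $xRy$. The condition $\mathsf{BEM}$ is: $x\leq y$ and $xRz$ imply $yRz$. *)

theory Defs
  imports Main "HOL-Library.Disjoint_Sets"
begin

datatype 'p form =
    Top
  | Bot
  | Var 'p
  | And "'p form" "'p form"
  | Or "'p form" "'p form"
  | Imp "'p form" "'p form"
  | Box "'p form"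

(* A valuation W \<rightarrow> P(Prop) is a total HOL function, of which only the values
   on the set of points are relevant. *)
record ('a, 'p) kripke =
  pts :: "'a set"
  le :: "'a rel"
  val :: "'a \<Rightarrow> 'p set"

record ('a, 'p) birel = "('a, 'p) kripke" +
  acc :: "'a rel"

record ('w, 'a, 'p) mixed =
  worlds :: "'w set"
  wacc :: "'w rel"
  component :: "'w \<Rightarrow> ('a, 'p) kripke"

definition kripke_model :: "('a, 'p, 'b) kripke_scheme \<Rightarrow> bool" where
  "kripke_model K \<longleftrightarrow>
     pts K \<noteq> {} \<and> partial_order_on (pts K) (le K) \<and>
     (\<forall>x y. (x, y) \<in> le K \<longrightarrow> val K x \<subseteq> val K y)"

definition is_root :: "('a, 'p, 'b) kripke_scheme \<Rightarrow> 'a \<Rightarrow> bool" where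
  "is_root K r \<longleftrightarrow> r \<in> pts K \<and> (\<forall>x\<in>pts K. (r, x) \<in> le K)"

definition rooted_kripke_model :: "('a, 'p, 'b) kripke_scheme \<Rightarrow> bool" where
  "rooted_kripke_model K \<longleftrightarrow> kripke_model K \<and> (\<exists>r. is_root K r)"

definition mixed_model :: "('w, 'a, 'p) mixed \<Rightarrow> bool" where
  "mixed_model M \<longleftrightarrow>
     worlds M \<noteq> {} \<and> wacc M \<subseteq> worlds M \<times> worlds M \<and>
     (\<forall>w\<in>worlds M. rooted_kripke_model (component M w)) \<and>
     disjoint_family_on (\<lambda>w. pts (component M w)) (worlds M)"

definition world_root :: "('w, 'a, 'p) mixed \<Rightarrow> 'w \<Rightarrow> 'a" where
  "world_root M w = (THE r. is_root (component M w) r)"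

definition mixed_le :: "('w, 'a, 'p) mixed \<Rightarrow> 'a rel" where
  "mixed_le M = (\<Union>w\<in>worlds M. le (component M w))"

(* The union of the valuations V_w, each of them with domain W_w. *)
definition mixed_val :: "('w, 'a, 'p) mixed \<Rightarrow> 'a \<Rightarrow> 'p set" where
  "mixed_val M x = (\<Union>w\<in>{w \<in> worlds M. x \<in> pts (component M w)}. val (component M w) x)"

primrec mixed_forces :: "('w, 'a, 'p) mixed \<Rightarrow> 'a \<Rightarrow> 'p form \<Rightarrow> bool" where
  "mixed_forces M x Top \<longleftrightarrow> True"
| "mixed_forces M x Bot \<longleftrightarrow> False"
| "mixed_forces M x (Var p) \<longleftrightarrow> p \<in> mixed_val M x"
| "mixed_forces M x (And \<phi> \<psi>) \<longleftrightarrow> mixed_forces M x \<phi> \<and> mixed_forces M x \<psi>"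
| "mixed_forces M x (Or \<phi> \<psi>) \<longleftrightarrow> mixed_forces M x \<phi> \<or> mixed_forces M x \<psi>"
| "mixed_forces M x (Imp \<phi> \<psi>) \<longleftrightarrow>
     (\<forall>y. (x, y) \<in> mixed_le M \<longrightarrow> mixed_forces M y \<phi> \<longrightarrow> mixed_forces M y \<psi>)"
| "mixed_forces M x (Box \<phi>) \<longleftrightarrow>
     (let w = (THE w. w \<in> worlds M \<and> (world_root M w, x) \<in> mixed_le M)
      in \<forall>v\<in>worlds M. (w, v) \<in> wacc M \<longrightarrow> mixed_forces M (world_root M v) \<phi>)"

definition birel_model :: "('a, 'p) birel \<Rightarrow> bool" where
  "birel_model B \<longleftrightarrow>
     kripke_model B \<and> acc B \<subseteq> pts B \<times> pts B \<and>
     (\<forall>x y z. (x, y) \<in> le B \<longrightarrow> (y, z) \<in> acc B \<longrightarrow> (x, z) \<in> acc B)"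

definition BEM :: "('a, 'p) birel \<Rightarrow> bool" where
  "BEM B \<longleftrightarrow> (\<forall>x y z. (x, y) \<in> le B \<longrightarrow> (x, z) \<in> acc B \<longrightarrow> (y, z) \<in> acc B)"

primrec birel_forces :: "('a, 'p) birel \<Rightarrow> 'a \<Rightarrow> 'p form \<Rightarrow> bool" where
  "birel_forces B x Top \<longleftrightarrow> True"
| "birel_forces B x Bot \<longleftrightarrow> False"
| "birel_forces B x (Var p) \<longleftrightarrow> p \<in> val B x"
| "birel_forces B x (And \<phi> \<psi>) \<longleftrightarrow> birel_forces B x \<phi> \<and> birel_forces B x \<psi>"
| "birel_forces B x (Or \<phi> \<psi>) \<longleftrightarrow> birel_forces B x \<phi> \<or> birel_forces B x \<psi>"
| "birel_forces B x (Imp \<phi> \<psi>) \<longleftrightarrow>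
     (\<forall>y. (x, y) \<in> le B \<longrightarrow> birel_forces B y \<phi> \<longrightarrow> birel_forces B y \<psi>)"
| "birel_forces B x (Box \<phi>) \<longleftrightarrow> (\<forall>y. (x, y) \<in> acc B \<longrightarrow> birel_forces B y \<phi>)"

definition birel_of :: "('w, 'a, 'p) mixed \<Rightarrow> ('a, 'p) birel" where
  "birel_of M =
     \<lparr> pts = (\<Union>w\<in>worlds M. pts (component M w)),
       le = {(x, y). \<exists>w\<in>worlds M. (x, y) \<in> le (component M w)},
       val = (\<lambda>x. val (component M (THE w. w \<in> worlds M \<and> x \<in> pts (component M w))) x),
       acc = {(x, y). \<exists>w\<in>worlds M. \<exists>v\<in>worlds M.
                (w, v) \<in> wacc M \<and> (world_root M w, x) \<in> le (component M w) \<and> y = world_root M v} \<rparr>"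

end

theory Submission
  imports Defs
begin

text \<open>
  By disjointness, a point determines the world of its component and \<open>\<le>'\<close> never leaves a
  component. Hence the \<open>R'\<close>-successors of \<open>x \<in> W\<^sub>w\<close> are exactly the roots of the worlds
  \<open>v\<close> with \<open>w R v\<close>, which depend on \<open>w\<close> only; this gives both the birelational condition and BEM,
  and it makes the two clauses for the modality agree.
\<close>

text \<open>Two roots lie below each other, so antisymmetry identifies them. This makes the
  description in \<open>world_root\<close> well defined.\<close>

lemma is_root_unique:
  assumes "kripke_model K" "is_root K r" "is_root K s"
  shows "r = s"
  using assms
  by (auto simp: kripke_model_def is_root_def partial_order_on_def dest: antisymD)

lemma kripke_model_le_pts:
  assumes "kripke_model K" "(x, y) \<in> le K"
  shows "x \<in> pts K" "y \<in> pts K"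
  using assms by (auto simp: kripke_model_def partial_order_on_def preorder_on_def)

lemma mixed_model_component:
  assumes "mixed_model M" "w \<in> worlds M"
  shows "kripke_model (component M w)"
  using assms by (auto simp: mixed_model_def rooted_kripke_model_def)

lemma is_root_world_root:
  assumes "mixed_model M" "w \<in> worlds M"
  shows "is_root (component M w) (world_root M w)"
proof -
  obtain r where r: "is_root (component M w) r"
    using assms by (auto simp: mixed_model_def rooted_kripke_model_def)
  show ?thesis
    unfolding world_root_def
    by (rule theI, rule r) (rule is_root_unique[OF mixed_model_component[OF assms] _ r])
qed

lemma world_unique:
  assumes "mixed_model M" "w \<in> worlds M" "v \<in> worlds M"
    and "x \<in> pts (component M w)" "x \<in> pts (component M v)"
  shows "v = w"
  using assms unfolding mixed_model_def disjoint_family_on_def by blast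

text \<open>One endpoint in the component of \<open>w\<close> is enough: a component order relates
  only its own points, so a world contributing the pair shares a point with \<open>w\<close> and
  equals it by disjointness.\<close>

lemma mixed_le_component_iff:
  assumes "mixed_model M" "w \<in> worlds M"
    and "x \<in> pts (component M w) \<or> y \<in> pts (component M w)"
  shows "(x, y) \<in> mixed_le M \<longleftrightarrow> (x, y) \<in> le (component M w)"
proof
  assume "(x, y) \<in> mixed_le M"
  then obtain v where v: "v \<in> worlds M" "(x, y) \<in> le (component M v)"
    by (auto simp: mixed_le_def)
  then have "x \<in> pts (component M v)" "y \<in> pts (component M v)"
    using kripke_model_le_pts[OF mixed_model_component[OF assms(1)]] by blast+
  then have "v = w"
    using world_unique[OF assms(1,2) v(1)] assms(3) by blast
  with v show "(x, y) \<in> le (component M w)" by simp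
qed (use assms in \<open>auto simp: mixed_le_def\<close>)

lemma mixed_leE:
  assumes "mixed_model M" "(x, y) \<in> mixed_le M"
  obtains w where "w \<in> worlds M" "x \<in> pts (component M w)" "y \<in> pts (component M w)"
    "(x, y) \<in> le (component M w)"
proof -
  obtain w where "w \<in> worlds M" "(x, y) \<in> le (component M w)"
    using assms(2) by (auto simp: mixed_le_def)
  with that kripke_model_le_pts[OF mixed_model_component[OF assms(1)]] show thesis
    by blast
qed

text \<open>Turns the root condition in the definition of \<open>R'\<close> into membership, to
  which disjointness applies.\<close>

lemma world_root_le_iff:
  assumes "mixed_model M" "w \<in> worlds M"
  shows "(world_root M w, x) \<in> le (component M w) \<longleftrightarrow> x \<in> pts (component M w)"
  using is_root_world_root[OF assms] kripke_model_le_pts[OF mixed_model_component[OF assms]]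
  by (auto simp: is_root_def)

lemma world_root_mixed_le_iff:
  assumes "mixed_model M" "w \<in> worlds M"
  shows "(world_root M w, x) \<in> mixed_le M \<longleftrightarrow> x \<in> pts (component M w)"
  using mixed_le_component_iff[OF assms] world_root_le_iff[OF assms] is_root_world_root[OF assms]
  by (simp add: is_root_def)

text \<open>Evaluates the description in the valuation of \<open>birel_of\<close> and, once root
  conditions are read as membership, the one in the forcing clause for \<open>Box\<close>.\<close>

lemma the_world_eq:
  assumes "mixed_model M" "w \<in> worlds M" "x \<in> pts (component M w)"
  shows "(THE w. w \<in> worlds M \<and> x \<in> pts (component M w)) = w"
  using assms(2,3) by (auto dest: world_unique[OF assms(1,2) _ assms(3)])

lemma pts_birel_of: "pts (birel_of M) = (\<Union>w\<in>worlds M. pts (component M w))"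
  by (simp add: birel_of_def)

lemma le_birel_of: "le (birel_of M) = mixed_le M"
  by (auto simp: birel_of_def mixed_le_def)

lemma val_birel_of:
  assumes "mixed_model M" "w \<in> worlds M" "x \<in> pts (component M w)"
  shows "val (birel_of M) x = val (component M w) x"
  using the_world_eq[OF assms] by (simp add: birel_of_def)

text \<open>By disjointness the union defining \<open>mixed_val\<close> has a single member, the
  same set that \<open>val_birel_of\<close> yields.\<close>

lemma mixed_val_component:
  assumes "mixed_model M" "w \<in> worlds M" "x \<in> pts (component M w)"
  shows "mixed_val M x = val (component M w) x"
  using assms(2,3) by (auto simp: mixed_val_def dest: world_unique[OF assms(1,2) _ assms(3)])

lemma acc_birel_of_iff:
  assumes "mixed_model M" "w \<in> worlds M" "x \<in> pts (component M w)"
  shows "(x, y) \<in> acc (birel_of M) \<longleftrightarrow> (\<exists>v\<in>worlds M. (w, v) \<in> wacc M \<and> y = world_root M v)"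
proof -
  \<comment> \<open>The source world \<open>u\<close> stays existential here; uniqueness of the
    world of \<open>x\<close> then forces \<open>u = w\<close>.\<close>
  have "(x, y) \<in> acc (birel_of M) \<longleftrightarrow>
    (\<exists>u\<in>worlds M. x \<in> pts (component M u) \<and>
      (\<exists>v\<in>worlds M. (u, v) \<in> wacc M \<and> y = world_root M v))"
    using world_root_le_iff[OF assms(1)] by (auto simp: birel_of_def)
  then show ?thesis
    using assms(2,3) by (auto dest: world_unique[OF assms(1,2) _ assms(3)])
qed

lemma acc_birel_of_subset:
  assumes "mixed_model M"
  shows "acc (birel_of M) \<subseteq> pts (birel_of M) \<times> pts (birel_of M)"
  using world_root_le_iff[OF assms] is_root_world_root[OF assms]
  by (auto simp: birel_of_def is_root_def)

text \<open>Right to left this is the birelational condition, left to right it is BEM.\<close>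

lemma acc_birel_of_le_cong:
  assumes "mixed_model M" "(x, y) \<in> mixed_le M"
  shows "(x, z) \<in> acc (birel_of M) \<longleftrightarrow> (y, z) \<in> acc (birel_of M)"
  using assms(2) by (elim mixed_leE[OF assms(1)]) (simp add: acc_birel_of_iff[OF assms(1)])

text \<open>Each law is inherited from the components: two pairs with a common point
  \<open>y\<close> lie in the same component, so its transitivity or antisymmetry applies.\<close>

lemma partial_order_on_mixed_le:
  assumes "mixed_model M"
  shows "partial_order_on (pts (birel_of M)) (mixed_le M)"
proof -
  let ?P = "\<lambda>w. pts (component M w)" and ?L = "\<lambda>w. le (component M w)"
  have po: "refl_on (?P w) (?L w)" "trans (?L w)" "antisym (?L w)" if "w \<in> worlds M" for w
    using mixed_model_component[OF assms that]
    by (auto simp: kripke_model_def partial_order_on_def preorder_on_def)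
  have "mixed_le M \<subseteq> pts (birel_of M) \<times> pts (birel_of M)"
    by (auto simp: pts_birel_of elim: mixed_leE[OF assms])
  moreover have "refl_on (pts (birel_of M)) (mixed_le M)"
    using po(1) by (fastforce simp: refl_on_def pts_birel_of mixed_le_def)
  moreover have "trans (mixed_le M)"
  proof (rule transI)
    fix x y z assume xy: "(x, y) \<in> mixed_le M" and yz: "(y, z) \<in> mixed_le M"
    from xy obtain w where w: "w \<in> worlds M" "y \<in> ?P w" "(x, y) \<in> ?L w"
      by (rule mixed_leE[OF assms])
    then have "(y, z) \<in> ?L w"
      using yz mixed_le_component_iff[OF assms] by blast
    with w po(2) have "(x, z) \<in> ?L w" by (blast dest: transD)
    with w(1) show "(x, z) \<in> mixed_le M" by (auto simp: mixed_le_def)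
  qed
  moreover have "antisym (mixed_le M)"
  proof (rule antisymI)
    fix x y assume xy: "(x, y) \<in> mixed_le M" and yx: "(y, x) \<in> mixed_le M"
    from xy obtain w where w: "w \<in> worlds M" "y \<in> ?P w" "(x, y) \<in> ?L w"
      by (rule mixed_leE[OF assms])
    then have "(y, x) \<in> ?L w"
      using yx mixed_le_component_iff[OF assms] by blast
    with w po(3) show "x = y" by (blast dest: antisymD)
  qed
  ultimately show ?thesis
    by (simp add: partial_order_on_def preorder_on_def)
qed

lemma kripke_model_birel_of:
  assumes "mixed_model M"
  shows "kripke_model (birel_of M)"
proof -
  have "pts (birel_of M) \<noteq> {}"
    using assms by (auto simp: mixed_model_def rooted_kripke_model_def kripke_model_def pts_birel_of)
  moreover have "val (birel_of M) x \<subseteq> val (birel_of M) y" if "(x, y) \<in> mixed_le M" for x y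
    using that
  \<comment> \<open>Comparable points share a component \<open>w\<close>, on which \<open>V'\<close>
    agrees with the monotone valuation of \<open>w\<close>.\<close>
  proof (rule mixed_leE[OF assms])
    fix w assume "w \<in> worlds M" "x \<in> pts (component M w)" "y \<in> pts (component M w)"
      "(x, y) \<in> le (component M w)"
    then show ?thesis
      using mixed_model_component[OF assms, of w]
      by (simp add: val_birel_of[OF assms] kripke_model_def)
  qed
  ultimately show ?thesis
    using partial_order_on_mixed_le[OF assms] by (simp add: kripke_model_def le_birel_of)
qed

lemma birel_model_birel_of:
  assumes "mixed_model M"
  shows "birel_model (birel_of M)"
  using kripke_model_birel_of[OF assms] acc_birel_of_subset[OF assms]
    acc_birel_of_le_cong[OF assms]
  by (auto simp: birel_model_def le_birel_of)

lemma BEM_birel_of: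
  assumes "mixed_model M"
  shows "BEM (birel_of M)"
  using acc_birel_of_le_cong[OF assms] by (auto simp: BEM_def le_birel_of)

lemma mixed_forces_Box_iff:
  assumes "mixed_model M" "w \<in> worlds M" "x \<in> pts (component M w)"
  shows "mixed_forces M x (Box \<phi>) \<longleftrightarrow>
    (\<forall>v\<in>worlds M. (w, v) \<in> wacc M \<longrightarrow> mixed_forces M (world_root M v) \<phi>)"
proof -
  have "(THE w. w \<in> worlds M \<and> (world_root M w, x) \<in> mixed_le M) = w"
    \<comment> \<open>The root condition amounts to membership only for actual worlds;
      \<open>conj_cong\<close> makes the first conjunct available while the second is
      rewritten.\<close>
    using the_world_eq[OF assms] world_root_mixed_le_iff[OF assms(1)]
    by (simp cong: conj_cong)
  then show ?thesis by simp
qed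

text \<open>The induction generalizes over \<open>w\<close> and \<open>x\<close>, since implication
  moves to other points and \<open>Box\<close> to roots of other worlds.\<close>

lemma mixed_forces_iff_birel_forces:
  assumes "mixed_model M" "w \<in> worlds M" "x \<in> pts (component M w)"
  shows "mixed_forces M x \<phi> \<longleftrightarrow> birel_forces (birel_of M) x \<phi>"
  using assms(2,3)
proof (induction \<phi> arbitrary: w x)
  case (Var p)
  then show ?case
    by (simp add: val_birel_of[OF assms(1)] mixed_val_component[OF assms(1)])
next
  case (Imp \<phi> \<psi>)
  \<comment> \<open>Any such \<open>y\<close> lies in some component, as the induction hypotheses
    require; both clauses range over the same \<open>y\<close> because the orders coincide.\<close>
  have "mixed_forces M y \<phi> = birel_forces (birel_of M) y \<phi> \<and>
      mixed_forces M y \<psi> = birel_forces (birel_of M) y \<psi>" if "(x, y) \<in> mixed_le M" for y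
    using that Imp.IH by (blast elim: mixed_leE[OF assms(1)])
  then show ?case by (auto simp: le_birel_of)
next
  case (Box \<phi>)
  \<comment> \<open>The induction hypothesis is used at the world \<open>v\<close>, whose root is a
    point of its own component.\<close>
  have "mixed_forces M (world_root M v) \<phi> = birel_forces (birel_of M) (world_root M v) \<phi>"
    if "v \<in> worlds M" for v
    using Box.IH that is_root_world_root[OF assms(1) that] by (simp add: is_root_def)
  then show ?case
    unfolding mixed_forces_Box_iff[OF assms(1) Box.prems]
    by (auto simp: acc_birel_of_iff[OF assms(1) Box.prems])
qed auto

theorem theorem3p3p1:
  fixes M :: "('w, 'a, 'p) mixed"
  assumes "mixed_model M"
  shows "birel_model (birel_of M) \<and> BEM (birel_of M) \<and>
    (\<forall>x \<in> pts (birel_of M). \<forall>\<phi>. mixed_forces M x \<phi> \<longleftrightarrow> birel_forces (birel_of M) x \<phi>)"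
  using birel_model_birel_of[OF assms] BEM_birel_of[OF assms]
    mixed_forces_iff_birel_forces[OF assms]
  by (auto simp: pts_birel_of)

end
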